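(* Let $v\in C^{\omega}(\mathbb{R}/\mathbb{Z},\mathbb{R})$ be nonconstant (real analytic). Then there exists a constant $c_0=c_0(v)$ such that $$L(\alpha,A^{(E-\lambda v)})\ge\ln\lambda+c_0$$ for all $(\alpha,E,\lambda)\in(\mathbb{R}/\mathbb{Z})\times\mathbb{R}\times(0,\infty)$.
   Context: The Schrödinger cocycle map is $A^{(E-\lambda v)}(x)=\begin{pmatrix}E-\lambda v(x)&-1\\1&0\end{pmatrix}$, $x\in\mathbb{R}/\mathbb{Z}$. For $\alpha\in\mathbb{R}/\mathbb{Z}$ (rational or irrational) and continuous $A:\mathbb{R}/\mathbb{Z}\to SL(2,\mathbb{C})$, put $A_n(x)=A(x+(n-1)\alpha)\cdots A(x)$ for $n\ge1$. The Lyapunov exponent is $L(\alpha,A)=\lim_{n\to\infty}\frac1n\int_{\mathbb{R}/\mathbb{Z}}\ln\|A_n(x)\|\,dx=\inf_{n\ge1}\frac1n\int_{\mathbb{R}/\mathbb{Z}}\ln\|A_n(x)\|\,dx$. *)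

theory Defs
  imports "HOL-Analysis.Analysis"
begin

(* Functions on the circle R/Z are 1-periodic functions on the real line, and a point of R/Z
   (in particular the frequency alpha) is given by an arbitrary real representative. *)

definition periodic_one :: "(real \<Rightarrow> 'a) \<Rightarrow> bool" where
  "periodic_one f \<longleftrightarrow> (\<forall>x. f (x + 1) = f x)"

definition real_analytic :: "(real \<Rightarrow> real) \<Rightarrow> bool" where
  "real_analytic f \<longleftrightarrow> (\<forall>x. \<exists>F. (\<lambda>h. f (x + h)) has_fps_expansion F)"

definition schrodinger_cocycle :: "(real \<Rightarrow> real) \<Rightarrow> real \<Rightarrow> complex^2^2" where
  "schrodinger_cocycle w x =
     vector [vector [complex_of_real (w x), - 1],
             vector [1, 0]]"

(* cocycle_iterate \<alpha> A n x = A (x + (n-1) \<alpha>) ** ... ** A (x + \<alpha>) ** A x *)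
primrec cocycle_iterate ::
    "real \<Rightarrow> (real \<Rightarrow> complex^2^2) \<Rightarrow> nat \<Rightarrow> real \<Rightarrow> complex^2^2" where
  "cocycle_iterate \<alpha> A 0 x = mat 1"
| "cocycle_iterate \<alpha> A (Suc n) x = A (x + real n * \<alpha>) ** cocycle_iterate \<alpha> A n x"

(* The operator norm for the Euclidean norm on C^2; the library's norm on the type
   complex^2^2 is the Hilbert-Schmidt norm instead. *)
definition matrix_opnorm :: "complex^2^2 \<Rightarrow> real" where
  "matrix_opnorm M = onorm (\<lambda>u. M *v u)"

definition lyapunov_exponent :: "real \<Rightarrow> (real \<Rightarrow> complex^2^2) \<Rightarrow> real" where
  "lyapunov_exponent \<alpha> A =
     lim (\<lambda>n. (1 / real n) * integral {0..1} (\<lambda>x. ln (matrix_opnorm (cocycle_iterate \<alpha> A n x))))"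

end

theory Submission
  imports Defs "HOL-Complex_Analysis.Conformal_Mappings"
begin

text \<open>
  The argument complexifies the phase. A real analytic periodic \<open>v\<close> extends to a holomorphic
  function \<open>V\<close> on a strip around the real line (\<open>periodic_real_analytic_extension\<close>), and so does
  the first column \<open>(p\<^sub>n, q\<^sub>n)\<close> of the iterated cocycle. This column never vanishes, so
  \<open>ln (\<bar>p\<^sub>n\<bar>\<^sup>2 + \<bar>q\<^sub>n\<bar>\<^sup>2)\<close> is a smooth subharmonic function, and its mean over a period at height
  \<open>y\<close> is a convex function of \<open>y\<close> (\<open>convex_on_integral_ln_sqnorm\<close>). At height \<open>0\<close> the mean is at most
  twice the integral whose \<open>1/n\<close> multiple defines the Lyapunov exponent.

  Put \<open>a = E / \<lambda>\<close>. Since \<open>V\<close> is not constant, there is a horizontal line close to the real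
  one on which \<open>\<bar>V - a\<bar> \<ge> c (1 + \<bar>a\<bar>)\<close>, with \<open>c\<close> independent of \<open>a\<close> (\<open>line_avoiding_value_uniform\<close>).
  With \<open>M = \<lambda> (1 + \<bar>a\<bar>)\<close>, the coefficient \<open>E - \<lambda> V\<close> is at least \<open>c M\<close> on that line, so the
  column grows at least like \<open>(c M / 2)\<^sup>n\<close> there as soon as \<open>c M \<ge> 2\<close>. On a second line, at least twice
  as far from the real one, the coefficient is at most a constant times \<open>M\<close>. Convexity compares
  the three heights and yields a mean growth rate of at least \<open>ln M\<close> minus a constant on the real line
  (\<open>lyapunov_exponent_ge\<close>); and \<open>M \<ge> \<lambda>\<close>. For \<open>\<lambda>\<close> below a fixed threshold it is enough that
  matrices of determinant \<open>1\<close> have operator norm at least \<open>1\<close>, so that the exponent is nonnegative.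
\<close>

section \<open>Convergence to the Lyapunov exponent\<close>

lemma fekete_convergent:
  fixes a :: "nat \<Rightarrow> real"
  assumes subadd: "\<And>m n. a (m + n) \<le> a m + a n" and nonneg: "\<And>n. 0 \<le> a n"
  shows "convergent (\<lambda>n. a n / real n)"
proof -
  define L where "L = (INF m\<in>{1..}. a m / real m)"
  have bdd: "bdd_below ((\<lambda>m. a m / real m) ` {1..})"
    by (intro bdd_belowI[of _ 0]) (auto simp: nonneg)
  have mult: "a (q * m) \<le> real q * a m" if "q \<ge> 1" for q m
    using that
  proof (induction q rule: dec_induct)
    case (step q)
    then show ?case using subadd[of m "q * m"] by (simp add: algebra_simps)
  qed simp
  have "(\<lambda>n. a n / real n) \<longlonglongrightarrow> L"
  proof (rule LIMSEQ_I)
    fix e :: real assume "e > 0"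
    then obtain m where m: "m \<ge> 1" "a m / real m < L + e / 2"
      using cINF_less_iff[OF _ bdd, of "L + e / 2"] unfolding L_def by auto
    define B where "B = (\<Sum>r<m. a r) + a m"
    have B: "a r \<le> B" if "r < m" for r
      using that member_le_sum[of r "{..<m}" a] add_increasing2[OF nonneg[of m]] unfolding B_def
      by (simp add: nonneg)
    have "B \<ge> 0" unfolding B_def by (intro add_nonneg_nonneg sum_nonneg nonneg)
    have up: "a n / real n \<le> a m / real m + B / real n" if "n \<ge> m" for n
    proof -
      have q: "n div m \<ge> 1" using that m by (simp add: div_greater_zero_iff Suc_le_eq)
      have "a n \<le> a (n div m * m) + a (n mod m)"
        using subadd[of "n div m * m" "n mod m"] by simp
      also have "\<dots> \<le> real (n div m) * a m + B"
        using mult[OF q] B[of "n mod m"] m by (intro add_mono) auto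
      also have "\<dots> \<le> (real n / real m) * a m + B"
        by (intro add_right_mono mult_right_mono nonneg of_nat_div_le_of_nat)
      finally show ?thesis using that m by (simp add: field_simps)
    qed
    obtain N where N: "real N > 2 * B / e" using reals_Archimedean2 by blast
    show "\<exists>N. \<forall>n\<ge>N. norm (a n / real n - L) < e"
    proof (intro exI allI impI)
      fix n assume n: "n \<ge> max (N + 1) m"
      have "2 * B / e < real n" using N n by linarith
      then have "B / real n < e / 2" using n \<open>e > 0\<close> by (simp add: field_simps)
      moreover have "L \<le> a n / real n"
        unfolding L_def using n by (intro cINF_lower bdd) auto
      ultimately show "norm (a n / real n - L) < e"
        unfolding real_norm_def using up[of n] n m by linarith
    qed
  qed
  then show ?thesis by (rule convergentI)
qed

lemma periodic_add_of_int:
  fixes f :: "'a::ring_1 \<Rightarrow> 'b"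
  assumes "\<And>x. f (x + 1) = f x"
  shows "f (x + of_int k) = f x"
proof (induction k rule: int_induct[where k = 0])
  case (step1 i) then show ?case using assms[of "x + of_int i"] by (simp add: algebra_simps)
next
  case (step2 i) then show ?case using assms[of "x + of_int (i - 1)"] by (simp add: algebra_simps)
qed simp

lemma integral_periodic_shift:
  fixes g :: "real \<Rightarrow> real"
  assumes cont: "continuous_on UNIV g" and per: "\<And>x. g (x + 1) = g x"
  shows "integral {0..1} (\<lambda>x. g (x + c)) = integral {0..1} g"
proof -
  have int: "g integrable_on {a..b}" for a b
    by (intro integrable_continuous_real continuous_on_subset[OF cont]) auto
  have sh: "integral {a+d..b+d} g = integral {a..b} (\<lambda>x. g (x + d))" for a b d
    using integral_shift_real_ivl[of "a + d" d "b + d" g] by simp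
  define d where "d = frac c"
  have d: "0 \<le> d" "d \<le> 1" unfolding d_def using frac_lt_1[of c] by (auto simp: less_imp_le)
  have "g (x + c) = g (x + d)" for x
    using periodic_add_of_int[of g, OF per, of "x + d" "floor c"] unfolding d_def frac_def by (simp add: algebra_simps)
  then have "integral {0..1} (\<lambda>x. g (x + c)) = integral {d..1+d} g"
    using sh[of 0 d 1] by simp
  also have "\<dots> = integral {d..1} g + integral {1..1+d} g"
    using Henstock_Kurzweil_Integration.integral_combine[of d 1 "1 + d" g] d int by simp
  also have "integral {1..1+d} g = integral {0..d} g"
    using sh[of 0 1 d] per by (simp add: add.commute)
  also have "integral {d..1} g + integral {0..d} g = integral {0..1} g"
    using Henstock_Kurzweil_Integration.integral_combine[of 0 d 1 g] d int by simp
  finally show ?thesis .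
qed

lemma norm_matrix_vector_le: "norm (M *v u) \<le> matrix_opnorm M * norm u"
  unfolding matrix_opnorm_def by (rule onorm[OF matrix_vector_mul_bounded_linear])

lemma matrix_opnorm_mult_le: "matrix_opnorm (M ** N) \<le> matrix_opnorm M * matrix_opnorm N"
  using onorm_compose[OF matrix_vector_mul_bounded_linear[of M] matrix_vector_mul_bounded_linear[of N]]
  unfolding matrix_opnorm_def by (simp add: o_def matrix_vector_mul_assoc)

lemma matrix_opnorm_nonneg: "0 \<le> matrix_opnorm M"
  unfolding matrix_opnorm_def by (rule onorm_pos_le[OF matrix_vector_mul_bounded_linear])

lemma norm_complex_vec2: "norm (u :: complex^2) = sqrt ((cmod (u $ 1))\<^sup>2 + (cmod (u $ 2))\<^sup>2)"
  by (simp add: norm_vec_def L2_set_def sum_2)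

lemma matrix_opnorm_ge_column:
  "sqrt ((cmod (M $ 1 $ j))\<^sup>2 + (cmod (M $ 2 $ j))\<^sup>2) \<le> matrix_opnorm M"
proof -
  have col: "(M *v axis j 1) $ i = M $ i $ j" for i
    using exhaust_2[of j] by (auto simp: matrix_vector_mult_def axis_def sum_2)
  have "norm (axis j (1::complex) :: complex^2) = 1"
  proof (cases "j = 1")
    case False
    then have "j = 2" using exhaust_2 by blast
    then show ?thesis by (simp add: norm_complex_vec2 axis_def)
  qed (simp add: norm_complex_vec2 axis_def)
  then show ?thesis
    using norm_matrix_vector_le[of M "axis j 1"]
    unfolding norm_complex_vec2[of "M *v axis j 1"] col by simp
qed

text \<open>The determinant is at most the product of the lengths of the two columns, by Cauchy-Schwarz,
  and each column is at most the operator norm.\<close>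
lemma matrix_opnorm_ge_1:
  assumes "det M = 1"
  shows "1 \<le> matrix_opnorm M"
proof -
  define a b c d where abcd: "a = cmod (M$1$1)" "b = cmod (M$1$2)" "c = cmod (M$2$1)" "d = cmod (M$2$2)"
  have "1 = cmod (M$1$1 * M$2$2 - M$1$2 * M$2$1)"
    using assms by (simp add: det_2)
  also have "\<dots> \<le> a * d + b * c"
    unfolding abcd by (rule order_trans[OF norm_triangle_ineq4]) (simp add: norm_mult)
  also have "\<dots> \<le> sqrt ((a\<^sup>2 + c\<^sup>2) * (b\<^sup>2 + d\<^sup>2))"
  proof (rule real_le_rsqrt)
    have "0 \<le> (a * b - c * d)\<^sup>2" by simp
    then show "(a * d + b * c)\<^sup>2 \<le> (a\<^sup>2 + c\<^sup>2) * (b\<^sup>2 + d\<^sup>2)"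
      by (simp add: power2_eq_square algebra_simps)
  qed
  also have "\<dots> \<le> matrix_opnorm M * matrix_opnorm M"
    unfolding real_sqrt_mult using matrix_opnorm_ge_column[of M 1] matrix_opnorm_ge_column[of M 2]
    by (intro mult_mono) (auto simp: abcd matrix_opnorm_nonneg)
  finally have "1\<^sup>2 \<le> (matrix_opnorm M)\<^sup>2" by (simp add: power2_eq_square)
  then show ?thesis using matrix_opnorm_nonneg power2_le_imp_le by blast
qed

lemma continuous_on_matrix_opnorm: "continuous_on UNIV matrix_opnorm"
proof -
  have bound: "matrix_opnorm M \<le> 4 * norm M" for M
    unfolding matrix_opnorm_def
  proof (rule onorm_le)
    fix u :: "complex^2"
    have e: "cmod (M $ i $ j * u $ j) \<le> norm M * norm u" for i j
      unfolding norm_mult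
      by (intro mult_mono order_trans[OF Finite_Cartesian_Product.norm_nth_le
            Finite_Cartesian_Product.norm_nth_le] Finite_Cartesian_Product.norm_nth_le) auto
    have c: "cmod ((M *v u) $ i) \<le> 2 * (norm M * norm u)" for i
      using order_trans[OF norm_triangle_ineq add_mono[OF e[of i 1] e[of i 2]]]
      by (simp add: matrix_vector_mult_def sum_2 mult.commute)
    have "norm (M *v u) \<le> (\<Sum>i\<in>UNIV. cmod ((M *v u) $ i))"
      unfolding norm_vec_def by (rule L2_set_le_sum) auto
    then show "norm (M *v u) \<le> 4 * norm M * norm u"
      using c[of 1] c[of 2] by (simp add: sum_2)
  qed
  have tri: "matrix_opnorm M \<le> matrix_opnorm N + 4 * norm (M - N)" for M N
  proof -
    have "matrix_opnorm M \<le> matrix_opnorm N + matrix_opnorm (M - N)"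
      unfolding matrix_opnorm_def
      using onorm_triangle[OF matrix_vector_mul_bounded_linear[of N] matrix_vector_mul_bounded_linear[of "M - N"]]
      by (simp add: matrix_vector_mult_diff_rdistrib)
    then show ?thesis using bound[of "M - N"] by linarith
  qed
  have "4-lipschitz_on UNIV matrix_opnorm"
  proof (rule lipschitz_onI)
    fix M N
    show "dist (matrix_opnorm M) (matrix_opnorm N) \<le> 4 * dist M N"
      using tri[of M N] tri[of N M] by (simp add: dist_norm norm_minus_commute)
  qed simp
  then show ?thesis by (rule lipschitz_on_continuous_on)
qed

lemma continuous_on_cocycle_iterate:
  assumes "continuous_on UNIV A"
  shows "continuous_on UNIV (cocycle_iterate \<alpha> A n)"
proof (induction n)
  case (Suc n)
  have A: "continuous_on UNIV (\<lambda>x. A (x + real n * \<alpha>))"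
    by (rule continuous_on_compose2[OF assms]) (auto intro!: continuous_intros)
  show ?case
    unfolding cocycle_iterate.simps matrix_matrix_mult_def
    by (intro continuous_on_vec_lambda continuous_intros A Suc.IH)
qed simp

lemma cocycle_iterate_add:
  "cocycle_iterate \<alpha> A (m + n) x = cocycle_iterate \<alpha> A m (x + real n * \<alpha>) ** cocycle_iterate \<alpha> A n x"
proof (induction m)
  case (Suc m)
  have "x + real n * \<alpha> + real m * \<alpha> = x + real (m + n) * \<alpha>" by (simp add: algebra_simps)
  then show ?case using Suc by (simp only: add_Suc cocycle_iterate.simps matrix_mul_assoc)
qed simp

lemma cocycle_iterate_periodic:
  assumes "\<And>x. A (x + 1) = A x"
  shows "cocycle_iterate \<alpha> A n (x + 1) = cocycle_iterate \<alpha> A n x"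
proof (induction n)
  case (Suc n)
  have "A (x + 1 + real n * \<alpha>) = A (x + real n * \<alpha>)"
    using assms[of "x + real n * \<alpha>"] by (simp add: algebra_simps)
  then show ?case using Suc by simp
qed simp

lemma det_cocycle_iterate:
  assumes "\<And>x. det (A x) = 1"
  shows "det (cocycle_iterate \<alpha> A n x) = 1"
  by (induction n) (auto simp: det_mul assms)

lemma continuous_on_ln_opnorm_cocycle:
  assumes cont: "continuous_on UNIV A" and det: "\<And>x. det (A x) = 1"
  shows "continuous_on UNIV (\<lambda>x. ln (matrix_opnorm (cocycle_iterate \<alpha> A n x)))"
proof (rule continuous_on_ln)
  show "continuous_on UNIV (\<lambda>x. matrix_opnorm (cocycle_iterate \<alpha> A n x))"
    by (rule continuous_on_compose2[OF continuous_on_matrix_opnorm continuous_on_cocycle_iterate[OF cont]]) simp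
  show "\<forall>x\<in>UNIV. matrix_opnorm (cocycle_iterate \<alpha> A n x) \<noteq> 0"
    using matrix_opnorm_ge_1[OF det_cocycle_iterate[of A, OF det]] not_one_le_zero by metis
qed

lemma integrable_ln_opnorm_cocycle:
  assumes "continuous_on UNIV A" "\<And>x. det (A x) = 1"
  shows "(\<lambda>x. ln (matrix_opnorm (cocycle_iterate \<alpha> A n x))) integrable_on {a..b}"
  by (intro integrable_continuous_real continuous_on_subset[OF continuous_on_ln_opnorm_cocycle] assms) simp

text \<open>Since \<^const>\<open>lim\<close> is an arbitrary value on divergent sequences, convergence has to be established
  before any bound on the finite-scale averages passes to the exponent. It comes from subadditivity:
  the cocycle identity splits an iterate into two, and translation invariance of the integral over
  a period removes the shift in the first factor.\<close>
lemma lyapunov_exponent_tendsto: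
  assumes cont: "continuous_on UNIV A" and per: "\<And>x. A (x + 1) = A x" and det: "\<And>x. det (A x) = 1"
  shows "(\<lambda>n. (1 / real n) * integral {0..1} (\<lambda>x. ln (matrix_opnorm (cocycle_iterate \<alpha> A n x))))
           \<longlonglongrightarrow> lyapunov_exponent \<alpha> A"
proof -
  define g where "g n x = ln (matrix_opnorm (cocycle_iterate \<alpha> A n x))" for n x
  have ge1: "1 \<le> matrix_opnorm (cocycle_iterate \<alpha> A n x)" for n x
    by (intro matrix_opnorm_ge_1 det_cocycle_iterate det)
  have gcont: "continuous_on UNIV (g n)" for n
    unfolding g_def[abs_def] by (intro continuous_on_ln_opnorm_cocycle cont det)
  have gper: "g n (x + 1) = g n x" for n x
    unfolding g_def by (simp add: cocycle_iterate_periodic[of A, OF per])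
  have int: "g n integrable_on {0..1}" "(\<lambda>x. g n (x + c)) integrable_on {0..1}" for n c
    by (intro integrable_continuous_real continuous_on_subset[OF gcont]
        continuous_on_compose2[OF gcont] continuous_intros; auto)+
  have "convergent (\<lambda>n. integral {0..1} (g n) / real n)"
  proof (rule fekete_convergent)
    fix m n
    have "g (m + n) x \<le> g m (x + real n * \<alpha>) + g n x" for x
    proof -
      have "g (m + n) x \<le> ln (matrix_opnorm (cocycle_iterate \<alpha> A m (x + real n * \<alpha>)) *
                               matrix_opnorm (cocycle_iterate \<alpha> A n x))"
        unfolding g_def using ge1[of "m + n" x]
        by (intro ln_mono) (auto simp: cocycle_iterate_add matrix_opnorm_mult_le)
      also have "\<dots> = g m (x + real n * \<alpha>) + g n x"
        unfolding g_def by (intro ln_mult_pos less_le_trans[OF zero_less_one ge1])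
      finally show ?thesis .
    qed
    then have "integral {0..1} (g (m + n)) \<le> integral {0..1} (\<lambda>x. g m (x + real n * \<alpha>) + g n x)"
      by (intro integral_le integrable_add int)
    also have "\<dots> = integral {0..1} (\<lambda>x. g m (x + real n * \<alpha>)) + integral {0..1} (g n)"
      by (intro integral_add int)
    also have "integral {0..1} (\<lambda>x. g m (x + real n * \<alpha>)) = integral {0..1} (g m)"
      by (intro integral_periodic_shift gcont gper)
    finally show "integral {0..1} (g (m + n)) \<le> integral {0..1} (g m) + integral {0..1} (g n)" .
  next
    fix n
    show "0 \<le> integral {0..1} (g n)"
      unfolding g_def by (intro integral_nonneg int(1)[unfolded g_def] ln_ge_zero ge1)
  qed
  then show ?thesis
    unfolding lyapunov_exponent_def g_def by (simp add: convergent_LIMSEQ_iff)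
qed

section \<open>Convexity of logarithmic means on horizontal lines\<close>

definition strip :: "real \<Rightarrow> complex set" where
  "strip d = {z. \<bar>Im z\<bar> < d}"

lemma open_strip: "open (strip d)"
  unfolding strip_def abs_less_iff by (auto intro!: open_Collect_conj open_Collect_less continuous_intros)

lemma convex_strip: "convex (strip d)"
proof -
  have "strip d = {z. Im z < d} \<inter> {z. Im z > - d}"
    by (auto simp: strip_def)
  then show ?thesis using convex_halfspace_Im_lt convex_halfspace_Im_gt by (simp add: convex_Int)
qed

text \<open>The squared Hilbert-space norm is used, rather than the modulus of one entry, because a
  never-vanishing holomorphic vector has a smooth logarithmic norm; a single entry could have zeros.\<close>
definition sqnorm :: "(complex \<Rightarrow> complex) \<Rightarrow> (complex \<Rightarrow> complex) \<Rightarrow> complex \<Rightarrow> real" where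
  "sqnorm f g z = (cmod (f z))\<^sup>2 + (cmod (g z))\<^sup>2"

lemma has_vector_derivative_along_line:
  assumes "(f has_field_derivative f') (at (z + of_real t * e))"
  shows "((\<lambda>s. f (z + of_real s * e)) has_vector_derivative f' * e) (at t)"
proof -
  have "((\<lambda>s. z + of_real s * e) has_vector_derivative e) (at t)"
    by (auto intro!: derivative_eq_intros)
  from field_vector_diff_chain_at[OF this assms] show ?thesis
    by (simp add: o_def mult.commute)
qed

text \<open>Treating a general direction \<open>e\<close> covers the horizontal (\<open>e = 1\<close>) and vertical (\<open>e = \<i>\<close>) second
  derivatives at once: their \<open>K\<close> terms carry the factor \<open>e\<^sup>2\<close> and cancel in the Laplacian.\<close>
lemma directional_derivatives_ln_sqnorm:
  fixes f g f1 g1 f2 g2 :: "complex \<Rightarrow> complex" and e z :: complex and t :: real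
  defines "H \<equiv> (\<lambda>z. f1 z * cnj (f z) + g1 z * cnj (g z))"
    and "K \<equiv> (\<lambda>z. f2 z * cnj (f z) + g2 z * cnj (g z))"
    and "w \<equiv> z + of_real t * e"
  assumes f: "(f has_field_derivative f1 w) (at w)" and g: "(g has_field_derivative g1 w) (at w)"
    and f1: "(f1 has_field_derivative f2 w) (at w)" and g1: "(g1 has_field_derivative g2 w) (at w)"
    and pos: "sqnorm f g w > 0"
  shows "((\<lambda>s. ln (sqnorm f g (z + of_real s * e))) has_real_derivative
           2 * Re (e * H w) / sqnorm f g w) (at t)"
    and "((\<lambda>s. 2 * Re (e * H (z + of_real s * e)) / sqnorm f g (z + of_real s * e)) has_real_derivative
           2 * (Re (e\<^sup>2 * K w) + (cmod e)\<^sup>2 * sqnorm f1 g1 w) / sqnorm f g w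
             - (2 * Re (e * H w) / sqnorm f g w)\<^sup>2) (at t)"
proof -
  have cnj: "((\<lambda>s. cnj (F s)) has_vector_derivative cnj F') (at t)"
    if "(F has_vector_derivative F') (at t)" for F F'
    using bounded_linear.has_vector_derivative[OF bounded_linear_cnj that] .
  have re: "((\<lambda>s. Re (F s)) has_real_derivative Re F') (at t)"
    if "(F has_vector_derivative F') (at t)" for F F'
    using bounded_linear.has_vector_derivative[OF bounded_linear_Re that]
    by (simp add: has_real_derivative_iff_has_vector_derivative)
  have vf: "((\<lambda>s. f (z + of_real s * e)) has_vector_derivative f1 w * e) (at t)"
    and vg: "((\<lambda>s. g (z + of_real s * e)) has_vector_derivative g1 w * e) (at t)"
    and vf1: "((\<lambda>s. f1 (z + of_real s * e)) has_vector_derivative f2 w * e) (at t)"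
    and vg1: "((\<lambda>s. g1 (z + of_real s * e)) has_vector_derivative g2 w * e) (at t)"
    using f g f1 g1 unfolding w_def by (auto intro!: has_vector_derivative_along_line)
  have N: "sqnorm f g z = Re (f z * cnj (f z) + g z * cnj (g z))" for z
    by (simp add: sqnorm_def complex_mult_cnj cmod_power2)
  have "((\<lambda>s. Re (f (z + of_real s * e) * cnj (f (z + of_real s * e)) +
                   g (z + of_real s * e) * cnj (g (z + of_real s * e)))) has_real_derivative
      Re ((f w * cnj (f1 w * e) + f1 w * e * cnj (f w)) + (g w * cnj (g1 w * e) + g1 w * e * cnj (g w)))) (at t)"
    unfolding w_def
    by (intro re has_vector_derivative_add has_vector_derivative_mult cnj
        vf[unfolded w_def] vg[unfolded w_def])
  then have dN: "((\<lambda>s. sqnorm f g (z + of_real s * e)) has_real_derivative 2 * Re (e * H w)) (at t)"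
    unfolding N H_def by (simp add: algebra_simps)
  then show "((\<lambda>s. ln (sqnorm f g (z + of_real s * e))) has_real_derivative
           2 * Re (e * H w) / sqnorm f g w) (at t)"
    using pos unfolding w_def by (auto intro!: derivative_eq_intros)
  have "((\<lambda>s. Re (e * (f1 (z + of_real s * e) * cnj (f (z + of_real s * e)) +
                   g1 (z + of_real s * e) * cnj (g (z + of_real s * e))))) has_real_derivative
      Re (e * ((f1 w * cnj (f1 w * e) + f2 w * e * cnj (f w)) + (g1 w * cnj (g1 w * e) + g2 w * e * cnj (g w))))) (at t)"
    unfolding w_def
    by (intro re has_vector_derivative_add has_vector_derivative_mult cnj has_vector_derivative_mult_right
        vf[unfolded w_def] vg[unfolded w_def] vf1[unfolded w_def] vg1[unfolded w_def])
  moreover have "Re (e * ((f1 w * cnj (f1 w * e) + f2 w * e * cnj (f w)) + (g1 w * cnj (g1 w * e) + g2 w * e * cnj (g w))))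
     = Re (e\<^sup>2 * K w) + (cmod e)\<^sup>2 * sqnorm f1 g1 w"
  proof -
    have "e * ((f1 w * cnj (f1 w * e) + f2 w * e * cnj (f w)) + (g1 w * cnj (g1 w * e) + g2 w * e * cnj (g w)))
       = e\<^sup>2 * K w + (e * cnj e) * (f1 w * cnj (f1 w) + g1 w * cnj (g1 w))"
      by (simp add: K_def algebra_simps power2_eq_square)
    moreover have "(e * cnj e) * (f1 w * cnj (f1 w) + g1 w * cnj (g1 w)) = of_real ((cmod e)\<^sup>2 * sqnorm f1 g1 w)"
      unfolding sqnorm_def complex_norm_square[symmetric] by simp
    ultimately show ?thesis by (simp only: plus_complex.sel Re_complex_of_real)
  qed
  ultimately have dH: "((\<lambda>s. Re (e * H (z + of_real s * e))) has_real_derivative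
       Re (e\<^sup>2 * K w) + (cmod e)\<^sup>2 * sqnorm f1 g1 w) (at t)"
    unfolding H_def by (simp only:)
  have "((\<lambda>s. 2 * Re (e * H (z + of_real s * e)) / sqnorm f g (z + of_real s * e)) has_real_derivative
      ((2 * (Re (e\<^sup>2 * K w) + (cmod e)\<^sup>2 * sqnorm f1 g1 w)) * sqnorm f g w -
       (2 * Re (e * H w)) * (2 * Re (e * H w))) / (sqnorm f g w * sqnorm f g w)) (at t)"
    unfolding w_def
    by (intro DERIV_divide DERIV_cmult dH[unfolded w_def] dN[unfolded w_def])
      (use pos in \<open>auto simp: w_def\<close>)
  moreover have "(2 * a * n - b * b) / (n * n) = 2 * a / n - (b / n)\<^sup>2" if "n > 0" for a b n :: real
    using that by (simp add: diff_divide_distrib power2_eq_square)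
  ultimately show "((\<lambda>s. 2 * Re (e * H (z + of_real s * e)) / sqnorm f g (z + of_real s * e)) has_real_derivative
           2 * (Re (e\<^sup>2 * K w) + (cmod e)\<^sup>2 * sqnorm f1 g1 w) / sqnorm f g w
             - (2 * Re (e * H w) / sqnorm f g w)\<^sup>2) (at t)"
    using pos by (simp only:)
qed

lemma cauchy_schwarz_complex_pair:
  "(cmod (a * cnj b + c * cnj d))\<^sup>2 \<le> ((cmod a)\<^sup>2 + (cmod c)\<^sup>2) * ((cmod b)\<^sup>2 + (cmod d)\<^sup>2)"
proof -
  have "cmod (a * cnj b + c * cnj d) \<le> cmod a * cmod b + cmod c * cmod d"
    by (rule order_trans[OF norm_triangle_ineq]) (simp add: norm_mult)
  then have "(cmod (a * cnj b + c * cnj d))\<^sup>2 \<le> (cmod a * cmod b + cmod c * cmod d)\<^sup>2"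
    by (rule power_mono) simp
  also have "\<dots> \<le> ((cmod a)\<^sup>2 + (cmod c)\<^sup>2) * ((cmod b)\<^sup>2 + (cmod d)\<^sup>2)"
    using zero_le_power2[of "cmod a * cmod d - cmod c * cmod b"]
    by (simp add: power2_eq_square algebra_simps)
  finally show ?thesis .
qed

text \<open>The function \<open>ln \<parallel>(f, g)\<parallel>\<^sup>2\<close> is subharmonic by Cauchy-Schwarz. Integrated over a horizontal
  period, its second \<open>x\<close>-derivative drops out, so the nonnegative Laplacian is all that remains of
  the second \<open>y\<close>-derivative of the mean.\<close>
lemma convex_on_integral_ln_sqnorm:
  fixes f g :: "complex \<Rightarrow> complex"
  assumes hol: "f holomorphic_on strip d" "g holomorphic_on strip d"
    and per: "\<And>z. f (z + 1) = f z" "\<And>z. g (z + 1) = g z"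
    and nz: "\<And>z. z \<in> strip d \<Longrightarrow> sqnorm f g z > 0"
  shows "convex_on {-d<..<d} (\<lambda>y. integral {0..1} (\<lambda>x. ln (sqnorm f g (Complex x y))))"
proof -
  define f1 g1 f2 g2 where fg: "f1 = deriv f" "g1 = deriv g" "f2 = deriv f1" "g2 = deriv g1"
  define H where "H z = f1 z * cnj (f z) + g1 z * cnj (g z)" for z
  define K where "K z = f2 z * cnj (f z) + g2 z * cnj (g z)" for z
  define N where "N = sqnorm f g"
  define D where "D e z = 2 * Re (e * H z) / N z" for e z
  define W where "W e z = 2 * (Re (e\<^sup>2 * K z) + (cmod e)\<^sup>2 * sqnorm f1 g1 z) / N z - (D e z)\<^sup>2" for e z
  note hol1 = holomorphic_deriv[OF hol(1) open_strip] holomorphic_deriv[OF hol(2) open_strip]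
  note hol2 = holomorphic_deriv[OF hol1(1) open_strip] holomorphic_deriv[OF hol1(2) open_strip]
  note cont = holomorphic_on_imp_continuous_on[OF hol(1)] holomorphic_on_imp_continuous_on[OF hol(2)]
    hol1[folded fg, THEN holomorphic_on_imp_continuous_on]
    hol2[folded fg, THEN holomorphic_on_imp_continuous_on]
  have dd: "((\<lambda>s. ln (N (z + of_real s * e))) has_real_derivative D e (z + of_real t * e)) (at t)"
           "((\<lambda>s. D e (z + of_real s * e)) has_real_derivative W e (z + of_real t * e)) (at t)"
    if "z + of_real t * e \<in> strip d" for z t e
    using directional_derivatives_ln_sqnorm[of f f1 z t e g g1 f2 g2] that nz
      holomorphic_derivI[OF hol(1) open_strip] holomorphic_derivI[OF hol(2) open_strip]
      holomorphic_derivI[OF hol1(1) open_strip] holomorphic_derivI[OF hol1(2) open_strip]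
    unfolding D_def W_def H_def K_def N_def fg by auto
  have dx: "((\<lambda>s. D 1 (Complex s y)) has_real_derivative W 1 (Complex t y)) (at t)"
    if "\<bar>y\<bar> < d" for y t
  proof -
    have eq: "Complex s y = \<i> * of_real y + of_real s * 1" for s
      by (simp add: complex_eq_iff)
    show ?thesis
      unfolding eq using that by (intro dd(2)) (simp add: strip_def)
  qed
  have dy: "((\<lambda>s. ln (N (Complex x s))) has_real_derivative D \<i> (Complex x t)) (at t)"
           "((\<lambda>s. D \<i> (Complex x s)) has_real_derivative W \<i> (Complex x t)) (at t)"
    if "\<bar>t\<bar> < d" for x t
  proof -
    have eq: "Complex x s = of_real x + of_real s * \<i>" for s
      by (simp add: complex_eq_iff)
    show "((\<lambda>s. ln (N (Complex x s))) has_real_derivative D \<i> (Complex x t)) (at t)"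
         "((\<lambda>s. D \<i> (Complex x s)) has_real_derivative W \<i> (Complex x t)) (at t)"
      unfolding eq using that by (intro dd; simp add: strip_def)+
  qed
  have cN: "continuous_on (strip d) N" "continuous_on (strip d) H" "continuous_on (strip d) K"
           "continuous_on (strip d) (sqnorm f1 g1)"
    unfolding N_def H_def K_def sqnorm_def[abs_def] by (intro continuous_intros cont)+
  have N0: "N z \<noteq> 0" if "z \<in> strip d" for z using nz[OF that] by (simp add: N_def)
  have cD: "continuous_on (strip d) (D e)" for e
    unfolding D_def[abs_def] by (intro continuous_intros cN) (simp add: N0)
  have cW: "continuous_on (strip d) (W e)" for e
    unfolding W_def[abs_def] by (intro continuous_intros cN cD) (auto simp add: N0)
  have comp: "continuous_on ({-d<..<d} \<times> cbox 0 1) (\<lambda>(y, x). F (Complex x y))"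
    if "continuous_on (strip d) F" for F :: "complex \<Rightarrow> real"
    unfolding case_prod_beta
    by (rule continuous_on_compose2[OF that]) (auto intro!: continuous_intros simp: strip_def)
  have comp1: "(\<lambda>x. F (Complex x y)) integrable_on {0..1}"
    if "continuous_on (strip d) F" "y \<in> {-d<..<d}" for F :: "complex \<Rightarrow> real" and y
    using that
    by (intro integrable_continuous_real continuous_on_compose2[OF that(1)])
      (auto intro!: continuous_intros simp: strip_def)
  have U: "at y within {-d<..<d} = at y" if "y \<in> {-d<..<d}" for y
    using that by (intro at_within_open) auto
  have lnN: "continuous_on (strip d) (\<lambda>z. ln (N z))"
    by (intro continuous_intros cN) (simp add: N0)
  \<comment> \<open>\<open>W 1 + W \<i>\<close> is the Laplacian of \<open>ln N\<close>.\<close>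
  have laplace: "W 1 z + W \<i> z \<ge> 0" if "z \<in> strip d" for z
  proof -
    have "W 1 z + W \<i> z = 4 * (sqnorm f1 g1 z * N z - (cmod (H z))\<^sup>2) / (N z)\<^sup>2"
      using N0[OF that] unfolding W_def D_def cmod_power2
      by (simp add: field_simps power2_eq_square)
    moreover have "(cmod (H z))\<^sup>2 \<le> sqnorm f1 g1 z * N z"
      using cauchy_schwarz_complex_pair[of "f1 z" "f z" "g1 z" "g z"]
      unfolding H_def N_def sqnorm_def .
    ultimately show ?thesis by simp
  qed
  have Nper: "N (z + 1) = N z" for z by (simp add: N_def sqnorm_def per)
  have der_per: "deriv h (z + 1) = deriv h z" if "\<And>z. h (z + 1) = h z" for h :: "complex \<Rightarrow> complex" and z
    unfolding deriv_def DERIV_shift that ..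
  have I1: "((\<lambda>y. integral {0..1} (\<lambda>x. ln (N (Complex x y)))) has_real_derivative
        integral {0..1} (\<lambda>x. D \<i> (Complex x y))) (at y)" if y: "y \<in> {-d<..<d}" for y
  proof -
    have "((\<lambda>y. integral (cbox 0 1) (\<lambda>x. ln (N (Complex x y)))) has_real_derivative
        integral (cbox 0 1) (\<lambda>x. D \<i> (Complex x y))) (at y within {-d<..<d})"
    proof (rule leibniz_rule_field_derivative)
      fix y x :: real assume y: "y \<in> {-d<..<d}"
      then show "(\<lambda>x. ln (N (Complex x y))) integrable_on cbox 0 1"
        using comp1[OF lnN] by simp
      show "((\<lambda>y. ln (N (Complex x y))) has_real_derivative D \<i> (Complex x y)) (at y within {-d<..<d})"
        using y by (intro has_field_derivative_at_within[OF dy(1)]) auto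
    qed (use y comp[OF cD] in simp_all)
    then show ?thesis using U[OF y] by simp
  qed
  have I2: "((\<lambda>y. integral {0..1} (\<lambda>x. D \<i> (Complex x y))) has_real_derivative
        integral {0..1} (\<lambda>x. W \<i> (Complex x y))) (at y)" if y: "y \<in> {-d<..<d}" for y
  proof -
    have "((\<lambda>y. integral (cbox 0 1) (\<lambda>x. D \<i> (Complex x y))) has_real_derivative
        integral (cbox 0 1) (\<lambda>x. W \<i> (Complex x y))) (at y within {-d<..<d})"
    proof (rule leibniz_rule_field_derivative)
      fix y x :: real assume y: "y \<in> {-d<..<d}"
      then show "(\<lambda>x. D \<i> (Complex x y)) integrable_on cbox 0 1"
        using comp1[OF cD] by simp
      show "((\<lambda>y. D \<i> (Complex x y)) has_real_derivative W \<i> (Complex x y)) (at y within {-d<..<d})"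
        using y by (intro has_field_derivative_at_within[OF dy(2)]) auto
    qed (use y comp[OF cW] in simp_all)
    then show ?thesis using U[OF y] by simp
  qed
  have I3: "0 \<le> integral {0..1} (\<lambda>x. W \<i> (Complex x y))" if y: "y \<in> {-d<..<d}" for y
  proof -
    have y': "\<bar>y\<bar> < d" using y by auto
    have "((\<lambda>x. W 1 (Complex x y)) has_integral (D 1 (Complex 1 y) - D 1 (Complex 0 y))) {0..1}"
      using dx[OF y']
      by (intro fundamental_theorem_of_calculus)
        (auto simp: has_real_derivative_iff_has_vector_derivative[symmetric] intro: has_field_derivative_at_within)
    moreover have "D 1 (Complex 1 y) = D 1 (Complex 0 y)"
    proof -
      have "Complex 1 y = Complex 0 y + 1" by (simp add: complex_eq_iff)
      then show ?thesis unfolding D_def H_def fg by (simp add: Nper per der_per)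
    qed
    ultimately have "integral {0..1} (\<lambda>x. W 1 (Complex x y)) = 0" by (simp add: integral_unique)
    then have "integral {0..1} (\<lambda>x. W \<i> (Complex x y)) =
      integral {0..1} (\<lambda>x. W 1 (Complex x y) + W \<i> (Complex x y))"
      by (subst integral_add) (auto intro!: comp1 cW y)
    also have "\<dots> \<ge> 0"
      using y' by (intro integral_nonneg integrable_add comp1 cW y laplace) (auto simp: strip_def)
    finally show ?thesis .
  qed
  show ?thesis
    unfolding N_def[symmetric]
    by (rule f''_ge0_imp_convex[OF _ I1 I2 I3]) auto
qed

section \<open>Holomorphic extension of periodic real analytic functions\<close>

lemma holomorphic_eq_from_reals:
  assumes "f holomorphic_on S" "g holomorphic_on S" "open S" "convex S"
    and x: "of_real x \<in> S" and eq: "\<And>t::real. of_real t \<in> S \<Longrightarrow> f (of_real t) = g (of_real t)"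
    and z: "z \<in> S"
  shows "f z = g z"
proof -
  have "(f z - g z) = 0"
  proof (rule analytic_continuation[of "\<lambda>z. f z - g z" S "of_real ` {t. of_real t \<in> S}" "of_real x"])
    show "(\<lambda>z. f z - g z) holomorphic_on S" by (intro holomorphic_intros assms)
    show "connected S" by (rule convex_connected[OF assms(4)])
    show "complex_of_real x islimpt complex_of_real ` {t. complex_of_real t \<in> S}"
      unfolding islimpt_approachable
    proof (intro allI impI)
      fix e :: real assume "e > 0"
      obtain r where r: "r > 0" "ball (complex_of_real x) r \<subseteq> S"
        using \<open>open S\<close> x open_contains_ball by blast
      define t where "t = x + min (e/2) (r/2)"
      have "dist (complex_of_real t) (complex_of_real x) = min (e/2) (r/2)"
        using r \<open>e > 0\<close> unfolding t_def dist_of_real by (simp add: dist_real_def)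
      moreover from this have "complex_of_real t \<in> S"
        using r by (intro subsetD[OF r(2)]) (simp add: dist_commute)
      ultimately show "\<exists>x'\<in>complex_of_real ` {t. complex_of_real t \<in> S}. x' \<noteq> complex_of_real x \<and> dist x' (complex_of_real x) < e"
        using r \<open>e > 0\<close> by (intro bexI[of _ "complex_of_real t"]) auto
    qed
  qed (use assms in auto)
  then show ?thesis by simp
qed

text \<open>The same coefficients, read as complex numbers, have the same radius of convergence.\<close>
lemma real_fps_complexify:
  fixes f :: "real \<Rightarrow> real"
  assumes "(\<lambda>h. f (x + h)) has_fps_expansion F"
  obtains r G where "r > 0" "G holomorphic_on ball (of_real x) r"
    "\<And>t. of_real t \<in> ball (complex_of_real x) r \<Longrightarrow> G (of_real t) = of_real (f t)"
proof -
  define C where "C = Abs_fps (\<lambda>n. complex_of_real (fps_nth F n))"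
  have rad: "fps_conv_radius C = fps_conv_radius F"
    unfolding fps_conv_radius_def C_def conv_radius_def by simp
  from assms have F: "fps_conv_radius F > 0" "eventually (\<lambda>z. eval_fps F z = f (x + z)) (nhds 0)"
    by (auto simp: has_fps_expansion_def)
  obtain r1 where r1: "r1 > 0" "\<And>z. dist z 0 < r1 \<Longrightarrow> eval_fps F z = f (x + z)"
    using F(2) unfolding eventually_nhds_metric by blast
  obtain r2 where r2: "0 < ereal r2" "ereal r2 < fps_conv_radius F"
    using F(1) ereal_dense2 by (metis (no_types) ereal_dense2)
  define r where "r = min r1 r2"
  have r: "r > 0" "ereal r \<le> ereal r2" using r1 r2 by (auto simp: r_def)
  show thesis
  proof (rule that[of r "\<lambda>z. eval_fps C (z - of_real x)"])
    have "(eval_fps C \<circ> (\<lambda>z. z - of_real x)) holomorphic_on ball (of_real x) r"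
    proof (rule holomorphic_on_compose)
      show "eval_fps C holomorphic_on (\<lambda>z. z - of_real x) ` ball (of_real x) r"
      proof (rule holomorphic_on_eval_fps, safe)
        fix z assume "z \<in> ball (complex_of_real x) r"
        then have "ereal (norm (z - of_real x)) < ereal r"
          by (simp add: dist_norm norm_minus_commute)
        then have "ereal (norm (z - of_real x)) < fps_conv_radius F"
          using r(2) r2(2) by (meson less_trans less_le_trans)
        then show "z - of_real x \<in> eball 0 (fps_conv_radius C)"
          by (simp add: rad)
      qed
    qed (intro holomorphic_intros)
    then show "(\<lambda>z. eval_fps C (z - of_real x)) holomorphic_on ball (of_real x) r"
      by (simp add: o_def)
    fix t assume "complex_of_real t \<in> ball (of_real x) r"
    then have t: "\<bar>t - x\<bar> < r" by (simp add: dist_of_real dist_real_def abs_minus_commute)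
    then have "ereal (norm (t - x)) < ereal r2" by (simp add: r_def)
    then have "ereal (norm (t - x)) < fps_conv_radius F"
      using r2(2) less_trans by blast
    then have "(\<lambda>n. complex_of_real (fps_nth F n * (t - x) ^ n)) sums of_real (eval_fps F (t - x))"
      by (intro sums_of_real sums_eval_fps)
    then have "eval_fps C (of_real t - of_real x) = of_real (eval_fps F (t - x))"
      unfolding C_def eval_fps_def[of "Abs_fps _"] by (simp add: sums_iff)
    then show "eval_fps C (of_real t - of_real x) = of_real (f t)"
      using r1(2)[of "t - x"] t by (simp add: r_def)
  qed (rule r)
qed

text \<open>Compactness of a period gives one radius \<open>d\<close> that works around every real point. Two discs with
  real centres meet in a convex set that contains, with each point, its real part; so the
  local extensions agree there by the identity theorem and glue to a function on the strip.\<close>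
lemma periodic_real_analytic_extension:
  fixes v :: "real \<Rightarrow> real"
  assumes "periodic_one v" "real_analytic v"
  obtains d V where "d > 0" "V holomorphic_on strip d"
    "\<And>t. V (complex_of_real t) = of_real (v t)" "\<And>z. V (z + 1) = V z"
proof -
  have vper: "v (t + 1) = v t" for t using assms by (simp add: periodic_one_def)
  have vper_int: "v (t + of_int k) = v t" for t and k :: int
    by (rule periodic_add_of_int[of v, OF vper])
  define ext where "ext B G \<longleftrightarrow> G holomorphic_on B \<and> (\<forall>t. of_real t \<in> B \<longrightarrow> G (of_real t) = complex_of_real (v t))" for B G
  define \<B> where "\<B> = {B. open B \<and> (\<exists>G. ext B G)}"
  have "compact (complex_of_real ` {0..1})"
    by (intro compact_continuous_image continuous_intros) auto
  moreover have "complex_of_real ` {0..1} \<subseteq> \<Union>\<B>"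
  proof safe
    fix x :: real
    obtain F where "(\<lambda>h. v (x + h)) has_fps_expansion F"
      using assms(2) unfolding real_analytic_def by blast
    from real_fps_complexify[OF this] obtain r G where "r > 0" "ext (ball (of_real x) r) G"
      unfolding ext_def by metis
    then have "ball (of_real x) r \<in> \<B>" "complex_of_real x \<in> ball (of_real x) r"
      unfolding \<B>_def by auto
    then show "complex_of_real x \<in> \<Union>\<B>" by blast
  qed
  moreover have "open B" if "B \<in> \<B>" for B using that by (simp add: \<B>_def)
  ultimately obtain d where d: "d > 0"
    "\<And>z. z \<in> complex_of_real ` {0..1} \<Longrightarrow> \<exists>B\<in>\<B>. ball z d \<subseteq> B"
    using Heine_Borel_lemma[of "complex_of_real ` {0..1}" \<B>] by metis
  have "\<exists>G. ext (ball (of_real x) d) G" for x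
  proof -
    define k where "k = floor x"
    have "frac x \<in> {0..1}" using frac_lt_1[of x] by (simp add: less_imp_le)
    then obtain B G where B: "ball (of_real (frac x)) d \<subseteq> B" "ext B G"
      using d(2)[of "of_real (frac x)"] unfolding \<B>_def by blast
    have sub: "z - of_int k \<in> B" if "z \<in> ball (of_real x) d" for z
      using that by (intro subsetD[OF B(1)])
        (simp add: frac_def k_def dist_norm algebra_simps)
    have "(G \<circ> (\<lambda>z. z - of_int k)) holomorphic_on ball (of_real x) d"
      using B(2) sub unfolding ext_def
      by (intro holomorphic_on_compose_gen[of _ _ _ B] holomorphic_intros) auto
    moreover have "G (of_real t - of_int k) = of_real (v t)" if "of_real t \<in> ball (complex_of_real x) d" for t
      using sub[OF that] B(2) vper_int[of "t - of_int k" k] unfolding ext_def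
      by (metis diff_add_cancel of_real_diff of_real_of_int_eq)
    ultimately show ?thesis unfolding ext_def by (intro exI[of _ "G \<circ> (\<lambda>z. z - of_int k)"]) auto
  qed
  then obtain G where G: "\<And>x. ext (ball (of_real x) d) (G x)" by metis
  have agree: "G x z = G y z" if "z \<in> ball (of_real x) d" "z \<in> ball (of_real y) d" for x y z
  proof (rule holomorphic_eq_from_reals[of "G x" "ball (of_real x) d \<inter> ball (of_real y) d" "G y" "Re z"])
    have "cmod (complex_of_real (Re z) - of_real a) \<le> cmod (z - of_real a)" for a
      using abs_Re_le_cmod[of "z - of_real a"] by (simp flip: of_real_diff)
    then show "complex_of_real (Re z) \<in> ball (of_real x) d \<inter> ball (of_real y) d"
      using that by (force simp: dist_norm norm_minus_commute intro: le_less_trans)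
    show "G x holomorphic_on ball (of_real x) d \<inter> ball (of_real y) d"
         "G y holomorphic_on ball (of_real x) d \<inter> ball (of_real y) d"
      using G unfolding ext_def by (auto intro: holomorphic_on_subset)
    show "G x (of_real t) = G y (of_real t)"
      if "of_real t \<in> ball (of_real x) d \<inter> ball (complex_of_real y) d" for t
      using G that unfolding ext_def by auto
  qed (use that in \<open>auto simp: convex_Int\<close>)
  define V0 where "V0 z = G (Re z) z" for z
  have in_ball: "z \<in> ball (of_real (Re z)) d" if "z \<in> strip d" for z
  proof -
    have "z - of_real (Re z) = \<i> * of_real (Im z)" by (simp add: complex_eq_iff)
    then show ?thesis using that by (simp add: strip_def dist_norm norm_minus_commute norm_mult)
  qed
  have hol: "V0 holomorphic_on strip d"
    unfolding holomorphic_on_def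
  proof
    fix z assume z: "z \<in> strip d"
    define B where "B = ball (complex_of_real (Re z)) d \<inter> strip d"
    have "G (Re z) holomorphic_on B"
      using G unfolding ext_def B_def by (auto intro: holomorphic_on_subset)
    then have "V0 holomorphic_on B"
    proof (rule holomorphic_transform)
      show "G (Re z) w = V0 w" if "w \<in> B" for w
        using agree[of w "Re z" "Re w"] in_ball[of w] that unfolding V0_def B_def by auto
    qed
    moreover have "open B" "z \<in> B" unfolding B_def using open_strip in_ball z by auto
    ultimately show "V0 field_differentiable (at z within strip d)"
      using holomorphic_on_imp_differentiable_at field_differentiable_at_within by blast
  qed
  have real: "V0 (of_real t) = of_real (v t)" for t
    using G[of t] d(1) unfolding ext_def V0_def by simp
  have shift: "z + 1 \<in> strip d" if "z \<in> strip d" for z using that by (simp add: strip_def)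
  have per: "V0 (z + 1) = V0 z" if "z \<in> strip d" for z
  proof (rule holomorphic_eq_from_reals[of "\<lambda>z. V0 (z + 1)" "strip d" V0 0])
    have "(V0 \<circ> (\<lambda>z. z + 1)) holomorphic_on strip d"
      using shift by (intro holomorphic_on_compose_gen[OF _ hol] holomorphic_intros) auto
    then show "(\<lambda>z. V0 (z + 1)) holomorphic_on strip d" by (simp add: o_def)
    show "V0 (of_real t + 1) = V0 (of_real t)" for t
      using real[of "t + 1"] real[of t] vper by simp
  qed (use hol open_strip convex_strip that d in \<open>auto simp: strip_def\<close>)
  \<comment> \<open>Outside the strip the glued function need not be periodic, so it is reset to \<open>0\<close> there.\<close>
  define V where "V z = (if z \<in> strip d then V0 z else 0)" for z
  show thesis
  proof (rule that[of d V])
    show "V holomorphic_on strip d"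
      using hol by (rule holomorphic_transform) (simp add: V_def)
    show "V (of_real t) = of_real (v t)" for t
      using real d by (simp add: V_def strip_def)
    show "V (z + 1) = V z" for z
      using per[of z] by (simp add: V_def strip_def)
  qed (rule d)
qed

section \<open>Lines on which a value is avoided\<close>

lemma periodic_shift_to_unit:
  fixes V :: "complex \<Rightarrow> 'b"
  assumes "\<And>z. V (z + 1) = V z"
  shows "V (Complex x y) = V (Complex (frac x) y)"
proof -
  have "Complex x y = Complex (frac x) y + of_int (floor x)"
    by (simp add: complex_eq_iff frac_def)
  then show ?thesis using periodic_add_of_int[of V, OF assms] by simp
qed

lemma periodic_holomorphic_bounded:
  assumes hol: "V holomorphic_on strip d" and per: "\<And>z. V (z + 1) = V z" and "r < d"
  obtains K where "K \<ge> 0" "\<And>x y. \<bar>y\<bar> \<le> r \<Longrightarrow> cmod (V (Complex x y)) \<le> K"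
proof -
  define R where "R = cbox (Complex 0 (- r)) (Complex 1 r)"
  have "R \<subseteq> strip d"
    using \<open>r < d\<close> by (auto simp: R_def strip_def cbox_complex_eq)
  then have "compact (V ` R)"
    unfolding R_def
    by (intro compact_continuous_image compact_cbox continuous_on_subset[OF holomorphic_on_imp_continuous_on[OF hol]])
  then obtain K where K: "\<And>z. z \<in> R \<Longrightarrow> cmod (V z) \<le> K"
    using compact_imp_bounded bounded_iff by (metis image_eqI)
  show thesis
  proof (rule that[of "max 0 K"])
    fix x y :: real assume "\<bar>y\<bar> \<le> r"
    then have "Complex (frac x) y \<in> R"
      using frac_lt_1[of x] by (auto simp: R_def cbox_complex_eq less_imp_le)
    then show "cmod (V (Complex x y)) \<le> max 0 K"
      using K periodic_shift_to_unit[of V, OF per] by (metis max.coboundedI2)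
  qed simp
qed

text \<open>A nonconstant holomorphic function takes the value \<open>a\<close> only finitely often in a period rectangle,
  so some height \<open>y\<close> is missed, and compactness of the period gives the positive distance.\<close>
lemma line_avoiding_value:
  assumes hol: "V holomorphic_on strip d" and per: "\<And>z. V (z + 1) = V z"
    and nonconst: "\<not> V constant_on strip d" and r: "0 < r" "r < d"
  shows "\<exists>y\<in>{0<..<r}. \<exists>m>0. \<forall>x::real. m \<le> cmod (V (Complex x y) - a)"
proof -
  define R where "R = cbox (Complex 0 0) (Complex 1 r)"
  have R: "R \<subseteq> strip d"
    using r by (auto simp: R_def strip_def cbox_complex_eq)
  have "\<not> (\<lambda>z. V z - a) constant_on strip d"
    using nonconst unfolding constant_on_def by (metis diff_add_cancel)
  then have fin: "finite {z\<in>R. V z - a = 0}"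
    using R by (intro holomorphic_compact_finite_zeros[of _ "strip d"] holomorphic_intros hol open_strip
        convex_connected convex_strip) (auto simp: R_def)
  obtain y where y: "y \<in> {0<..<r}" "y \<notin> Im ` {z\<in>R. V z - a = 0}"
    using fin infinite_Ioo[OF r(1)] by (meson finite_imageI finite_subset subsetI)
  have nz: "V (Complex x y) - a \<noteq> 0" if "x \<in> {0..1}" for x
  proof
    assume "V (Complex x y) - a = 0"
    moreover have "Complex x y \<in> R" using y that by (auto simp: R_def cbox_complex_eq)
    ultimately show False using y(2) by (metis (mono_tags, lifting) complex.sel(2) image_eqI mem_Collect_eq)
  qed
  have cont: "continuous_on {0..1} (\<lambda>x. cmod (V (Complex x y) - a))"
    using y r by (intro continuous_intros continuous_on_compose2[OF holomorphic_on_imp_continuous_on[OF hol]])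
      (auto simp: strip_def)
  obtain x0 where x0: "x0 \<in> {0..1}" "\<And>x. x \<in> {0..1} \<Longrightarrow> cmod (V (Complex x0 y) - a) \<le> cmod (V (Complex x y) - a)"
    using continuous_attains_inf[OF compact_Icc _ cont] by auto
  show ?thesis
  proof (intro bexI[OF _ y(1)] exI[of _ "cmod (V (Complex x0 y) - a)"] conjI allI)
    show "0 < cmod (V (Complex x0 y) - a)" using nz[OF x0(1)] by simp
    fix x :: real
    have "frac x \<in> {0..1}" using frac_lt_1[of x] by (simp add: less_imp_le)
    then show "cmod (V (Complex x0 y) - a) \<le> cmod (V (Complex x y) - a)"
      using x0(2) periodic_shift_to_unit[of V x y, OF per] by metis
  qed
qed

text \<open>The scale \<open>1 + \<bar>a\<bar>\<close> treats bounded and unbounded energies alike. For large \<open>\<bar>a\<bar>\<close> any line close to the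
  real one works;
  the remaining values form a compact interval, where finitely many lines suffice because the
  line found for one value also serves the nearby ones.\<close>
lemma line_avoiding_value_uniform:
  assumes hol: "V holomorphic_on strip d" and per: "\<And>z. V (z + 1) = V z"
    and nonconst: "\<not> V constant_on strip d" and r: "0 < r" "r < d"
  obtains c :: real where "c > 0"
    "\<And>a::real. \<exists>y\<in>{0<..<r}. \<forall>x::real. c * (1 + \<bar>a\<bar>) \<le> cmod (V (Complex x y) - a)"
proof -
  obtain K where K: "K \<ge> 0" "\<And>x y. \<bar>y\<bar> \<le> r \<Longrightarrow> cmod (V (Complex x y)) \<le> K"
    using periodic_holomorphic_bounded[OF hol per r(2)] by blast
  define A where "A = 2 * K + 1"
  have "\<forall>a::real. \<exists>y m. y \<in> {0<..<r} \<and> m > 0 \<and> (\<forall>x::real. m \<le> cmod (V (Complex x y) - a))"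
    using line_avoiding_value[OF assms] by metis
  then obtain y m where ym: "\<And>a::real. y a \<in> {0<..<r}" "\<And>a::real. m a > (0::real)"
    "\<And>(a::real) x. m a \<le> cmod (V (Complex x (y a)) - a)"
    by metis
  have "{-A..A} \<subseteq> (\<Union>a\<in>{-A..A}. ball a (m a / 2))"
    using ym(2) by force
  then obtain F where F: "F \<subseteq> {-A..A}" "finite F" "{-A..A} \<subseteq> (\<Union>a\<in>F. ball a (m a / 2))"
    by (rule compactE_image[OF compact_Icc open_ball])
  define c0 where "c0 = Min (insert 1 (m ` F)) / 2"
  have c0: "c0 > 0" "\<And>a. a \<in> F \<Longrightarrow> c0 \<le> m a / 2"
    using F(2) ym(2) unfolding c0_def by auto
  show thesis
  proof (rule that[of "min (1/2) (c0 / (1 + A))"])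
    have "A > 0" using K(1) by (simp add: A_def)
    then show "min (1/2) (c0 / (1 + A)) > 0" using c0 by simp
    fix a :: real
    show "\<exists>y\<in>{0<..<r}. \<forall>x::real. min (1/2) (c0 / (1 + A)) * (1 + \<bar>a\<bar>) \<le> cmod (V (Complex x y) - a)"
    proof (cases "\<bar>a\<bar> \<le> A")
      case True
      then have "a \<in> {-A..A}" by (auto simp: abs_le_iff)
      then obtain b where "b \<in> F" "a \<in> ball b (m b / 2)" using F(3) by blast
      then have b: "b \<in> F" "\<bar>b - a\<bar> < m b / 2" by (simp_all add: dist_real_def)
      have "min (1/2) (c0 / (1 + A)) * (1 + \<bar>a\<bar>) \<le> cmod (V (Complex x (y b)) - a)" for x
      proof -
        have "min (1/2) (c0 / (1 + A)) * (1 + \<bar>a\<bar>) \<le> c0 / (1 + A) * (1 + A)"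
          using True c0 \<open>A > 0\<close> by (intro mult_mono) auto
        also have "\<dots> = c0" using \<open>A > 0\<close> by simp
        also have "\<dots> \<le> m b - \<bar>b - a\<bar>" using c0(2)[OF b(1)] b(2) by linarith
        also have "\<dots> \<le> cmod (V (Complex x (y b)) - b) - cmod (of_real a - of_real b)"
          using ym(3)[of b x] by (simp add: norm_of_real abs_minus_commute flip: of_real_diff)
        also have "\<dots> \<le> cmod (V (Complex x (y b)) - a)"
          using norm_triangle_ineq2[of "V (Complex x (y b)) - b" "of_real a - of_real b"] by simp
        finally show ?thesis .
      qed
      then show ?thesis using ym(1) by blast
    next
      case False
      have "min (1/2) (c0 / (1 + A)) * (1 + \<bar>a\<bar>) \<le> cmod (V (Complex x (r/2)) - a)" for x
      proof -
        have "min (1/2) (c0 / (1 + A)) * (1 + \<bar>a\<bar>) \<le> 1/2 * (1 + \<bar>a\<bar>)"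
          by (intro mult_right_mono min.cobounded1) simp
        also have "\<dots> \<le> \<bar>a\<bar> - K" using False by (simp add: A_def)
        also have "\<dots> \<le> cmod (of_real a) - cmod (V (Complex x (r/2)))"
          using K(2)[of "r/2" x] r by simp
        also have "\<dots> \<le> cmod (V (Complex x (r/2)) - a)"
          by (metis norm_minus_commute norm_triangle_ineq2)
        finally show ?thesis .
      qed
      then show ?thesis using r by (intro bexI[of _ "r/2"]) auto
    qed
  qed
qed

section \<open>Solutions of the complexified difference equation\<close>

text \<open>The first column of the \<open>n\<close>-th iterate consists of the values at \<open>n + 1\<close> and \<open>n\<close> of the solution
  of the second-order difference equation with initial values \<open>0\<close> and \<open>1\<close>. Here the coefficient \<open>w\<close>
  is complex, which allows phases off the real line.\<close>
fun schrodinger_solution :: "(complex \<Rightarrow> complex) \<Rightarrow> real \<Rightarrow> nat \<Rightarrow> complex \<Rightarrow> complex" where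
  "schrodinger_solution w \<alpha> 0 z = 0"
| "schrodinger_solution w \<alpha> (Suc 0) z = 1"
| "schrodinger_solution w \<alpha> (Suc (Suc n)) z =
     w (z + of_real (real n * \<alpha>)) * schrodinger_solution w \<alpha> (Suc n) z - schrodinger_solution w \<alpha> n z"

lemma cocycle_iterate_column:
  assumes "\<And>t. w (of_real t) = of_real (u t)"
  shows "cocycle_iterate \<alpha> (schrodinger_cocycle u) n x $ 1 $ 1 = schrodinger_solution w \<alpha> (Suc n) (of_real x)"
    and "cocycle_iterate \<alpha> (schrodinger_cocycle u) n x $ 2 $ 1 = schrodinger_solution w \<alpha> n (of_real x)"
proof (induction n)
  case (Suc n)
  have "w (of_real x + of_real (real n * \<alpha>)) = of_real (u (x + real n * \<alpha>))"
    using assms[of "x + real n * \<alpha>"] by simp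
  then show "cocycle_iterate \<alpha> (schrodinger_cocycle u) (Suc n) x $ 1 $ 1 = schrodinger_solution w \<alpha> (Suc (Suc n)) (of_real x)"
    and "cocycle_iterate \<alpha> (schrodinger_cocycle u) (Suc n) x $ 2 $ 1 = schrodinger_solution w \<alpha> (Suc n) (of_real x)"
    using Suc by (simp_all add: matrix_matrix_mult_def sum_2 schrodinger_cocycle_def[of u "x + _"])
qed (simp_all add: mat_def)

lemma holomorphic_schrodinger_solution:
  assumes "w holomorphic_on strip d"
  shows "schrodinger_solution w \<alpha> n holomorphic_on strip d"
proof (induction n rule: less_induct)
  case (less n)
  have w: "(\<lambda>z. w (z + of_real s)) holomorphic_on strip d" for s
  proof -
    have "(w \<circ> (\<lambda>z. z + of_real s)) holomorphic_on strip d"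
      by (intro holomorphic_on_compose_gen[OF _ assms] holomorphic_intros) (auto simp: strip_def)
    then show ?thesis by (simp add: o_def)
  qed
  consider "n = 0" | "n = 1" | k where "n = Suc (Suc k)"
    by (metis One_nat_def not0_implies_Suc)
  then show ?case
  proof cases
    case 3
    have "(\<lambda>z. w (z + of_real (real k * \<alpha>)) * schrodinger_solution w \<alpha> (Suc k) z - schrodinger_solution w \<alpha> k z)
        holomorphic_on strip d"
      by (intro holomorphic_intros w less.IH) (auto simp: 3)
    then show ?thesis by (simp add: 3 cong: holomorphic_cong)
  qed (auto cong: holomorphic_cong)
qed

lemma schrodinger_solution_periodic:
  assumes "\<And>z. w (z + 1) = w z"
  shows "schrodinger_solution w \<alpha> n (z + 1) = schrodinger_solution w \<alpha> n z"
  using assms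
proof (induction w \<alpha> n z rule: schrodinger_solution.induct)
  case (3 w \<alpha> n z)
  have "w (z + 1 + of_real (real n * \<alpha>)) = w (z + of_real (real n * \<alpha>))"
    using 3(3)[of "z + of_real (real n * \<alpha>)"] by (simp add: add_ac)
  then show ?case using 3 by simp
qed simp_all

lemma sqnorm_schrodinger_solution_pos:
  "sqnorm (schrodinger_solution w \<alpha> (Suc n)) (schrodinger_solution w \<alpha> n) z > 0"
proof -
  have "schrodinger_solution w \<alpha> (Suc n) z \<noteq> 0 \<or> schrodinger_solution w \<alpha> n z \<noteq> 0"
    by (induction n) auto
  then show ?thesis unfolding sqnorm_def by (auto simp: add_pos_nonneg add_nonneg_pos)
qed

text \<open>Where the coefficient is at least \<open>2\<close> in modulus, the cone \<open>\<bar>q\<bar> \<le> \<bar>p\<bar>\<close> is invariant and the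
  dominant component grows at least by the factor \<open>b - 1 \<ge> b / 2\<close>.\<close>
lemma schrodinger_solution_growth:
  assumes "\<And>s. b \<le> cmod (w (z + of_real s))" "b \<ge> 2"
  shows "cmod (schrodinger_solution w \<alpha> n z) \<le> cmod (schrodinger_solution w \<alpha> (Suc n) z)"
    and "(b / 2) ^ n \<le> cmod (schrodinger_solution w \<alpha> (Suc n) z)"
proof (induction n)
  case (Suc n)
  let ?p = "cmod (schrodinger_solution w \<alpha> (Suc n) z)" and ?q = "cmod (schrodinger_solution w \<alpha> n z)"
  have "b * ?p - ?q \<le> cmod (w (z + of_real (real n * \<alpha>))) * ?p - ?q"
    by (intro diff_right_mono mult_right_mono assms) auto
  also have "\<dots> \<le> cmod (schrodinger_solution w \<alpha> (Suc (Suc n)) z)"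
    unfolding schrodinger_solution.simps norm_mult[symmetric] by (rule norm_triangle_ineq2)
  finally have step: "b * ?p - ?p \<le> cmod (schrodinger_solution w \<alpha> (Suc (Suc n)) z)"
    using Suc.IH(1) by linarith
  have "b / 2 * ?p \<le> b * ?p - ?p"
    using mult_right_mono[of 1 "b / 2" ?p] assms(2) by (simp add: algebra_simps)
  then have half: "b / 2 * ?p \<le> cmod (schrodinger_solution w \<alpha> (Suc (Suc n)) z)"
    using step by linarith
  then show "?p \<le> cmod (schrodinger_solution w \<alpha> (Suc (Suc n)) z)"
    using mult_right_mono[of 1 "b / 2" ?p] assms(2) by simp
  have "(b / 2) ^ Suc n \<le> b / 2 * ?p"
    using Suc.IH(2) assms(2) by (simp only: power_Suc) (intro mult_left_mono, auto)
  then show "(b / 2) ^ Suc n \<le> cmod (schrodinger_solution w \<alpha> (Suc (Suc n)) z)"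
    using half by linarith
qed simp_all

lemma schrodinger_solution_upper:
  assumes "\<And>s. cmod (w (z + of_real s)) \<le> B"
  shows "cmod (schrodinger_solution w \<alpha> n z) \<le> (B + 1) ^ n"
proof -
  have B: "0 \<le> B" using order_trans[OF norm_ge_zero assms] by blast
  have "cmod (schrodinger_solution w \<alpha> n z) \<le> (B + 1) ^ n \<and>
        cmod (schrodinger_solution w \<alpha> (Suc n) z) \<le> (B + 1) ^ Suc n"
  proof (induction n)
    case (Suc n)
    have "cmod (schrodinger_solution w \<alpha> (Suc (Suc n)) z) \<le>
        cmod (w (z + of_real (real n * \<alpha>))) * cmod (schrodinger_solution w \<alpha> (Suc n) z)
          + cmod (schrodinger_solution w \<alpha> n z)"
      unfolding schrodinger_solution.simps norm_mult[symmetric] by (rule norm_triangle_ineq4)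
    also have "\<dots> \<le> B * (B + 1) ^ Suc n + (B + 1) ^ n"
      using Suc B by (intro add_mono mult_mono assms) auto
    also have "\<dots> \<le> B * (B + 1) ^ Suc n + (B + 1) ^ Suc n"
      using B by (intro add_left_mono power_increasing) auto
    also have "\<dots> = (B + 1) ^ Suc (Suc n)" by (simp add: algebra_simps)
    finally show ?case using Suc by blast
  qed (use B in auto)
  then show ?thesis by blast
qed

definition log_mean :: "(complex \<Rightarrow> complex) \<Rightarrow> real \<Rightarrow> nat \<Rightarrow> real \<Rightarrow> real" where
  "log_mean w \<alpha> n y = integral {0..1}
     (\<lambda>x. ln (sqnorm (schrodinger_solution w \<alpha> (Suc n)) (schrodinger_solution w \<alpha> n) (Complex x y)))"

lemma integrable_log_mean:
  assumes "w holomorphic_on strip d" "\<bar>y\<bar> < d"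
  shows "(\<lambda>x. ln (sqnorm (schrodinger_solution w \<alpha> (Suc n)) (schrodinger_solution w \<alpha> n) (Complex x y)))
    integrable_on {0..1}"
proof (intro integrable_continuous_real continuous_on_ln)
  have "continuous_on {0..1} (\<lambda>x. schrodinger_solution w \<alpha> k (Complex x y))" for k
    by (rule continuous_on_compose2[OF holomorphic_on_imp_continuous_on[OF
          holomorphic_schrodinger_solution[OF assms(1)]]])
      (use assms(2) in \<open>auto intro!: continuous_intros simp: strip_def\<close>)
  then show "continuous_on {0..1}
      (\<lambda>x. sqnorm (schrodinger_solution w \<alpha> (Suc n)) (schrodinger_solution w \<alpha> n) (Complex x y))"
    unfolding sqnorm_def by (intro continuous_intros)
qed (metis sqnorm_schrodinger_solution_pos less_irrefl)

lemma log_mean_lower: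
  assumes hol: "w holomorphic_on strip d" and y: "\<bar>y\<bar> < d"
    and b: "\<And>x. b \<le> cmod (w (Complex x y))" "b \<ge> 2"
  shows "2 * real n * ln (b / 2) \<le> log_mean w \<alpha> n y"
proof -
  have pt: "2 * real n * ln (b / 2) \<le>
    ln (sqnorm (schrodinger_solution w \<alpha> (Suc n)) (schrodinger_solution w \<alpha> n) (Complex x y))" for x
  proof -
    have "b \<le> cmod (w (Complex x y + of_real s))" for s
      using b(1)[of "x + s"] by (metis Complex_add_complex_of_real)
    from schrodinger_solution_growth(2)[of b w "Complex x y", OF this b(2)]
    have "((b / 2) ^ n)\<^sup>2 \<le> (cmod (schrodinger_solution w \<alpha> (Suc n) (Complex x y)))\<^sup>2"
      using b(2) by (intro power_mono) auto
    then have "(b / 2) ^ (2 * n) \<le>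
        sqnorm (schrodinger_solution w \<alpha> (Suc n)) (schrodinger_solution w \<alpha> n) (Complex x y)"
      unfolding sqnorm_def by (simp add: power_mult[symmetric] mult.commute add_increasing2)
    then have "ln ((b / 2) ^ (2 * n)) \<le>
        ln (sqnorm (schrodinger_solution w \<alpha> (Suc n)) (schrodinger_solution w \<alpha> n) (Complex x y))"
      using b(2) by (intro ln_mono) auto
    then show ?thesis using b(2) by (simp add: ln_realpow)
  qed
  have "integral {0..1::real} (\<lambda>x. 2 * real n * ln (b / 2)) \<le> log_mean w \<alpha> n y"
    unfolding log_mean_def by (intro integral_le integrable_log_mean[OF hol y] pt) auto
  then show ?thesis by simp
qed

lemma log_mean_upper:
  assumes hol: "w holomorphic_on strip d" and y: "\<bar>y\<bar> < d"
    and B: "\<And>x. cmod (w (Complex x y)) \<le> B"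
  shows "log_mean w \<alpha> n y \<le> ln 2 + 2 * real (Suc n) * ln (B + 1)"
proof -
  have B0: "0 \<le> B" using order_trans[OF norm_ge_zero B] by blast
  have pt: "ln (sqnorm (schrodinger_solution w \<alpha> (Suc n)) (schrodinger_solution w \<alpha> n) (Complex x y))
     \<le> ln 2 + 2 * real (Suc n) * ln (B + 1)" for x
  proof -
    have "cmod (w (Complex x y + of_real s)) \<le> B" for s
      using B[of "x + s"] by (metis Complex_add_complex_of_real)
    note up = schrodinger_solution_upper[of w "Complex x y" B \<alpha>, OF this]
    have "cmod (schrodinger_solution w \<alpha> n (Complex x y)) \<le> (B + 1) ^ Suc n"
      using up[of n] power_increasing[of n "Suc n" "B + 1"] B0 by linarith
    then have "sqnorm (schrodinger_solution w \<alpha> (Suc n)) (schrodinger_solution w \<alpha> n) (Complex x y)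
       \<le> ((B + 1) ^ Suc n)\<^sup>2 + ((B + 1) ^ Suc n)\<^sup>2"
      unfolding sqnorm_def using up[of "Suc n"] by (intro add_mono power_mono) auto
    also have "\<dots> = 2 * (B + 1) ^ (2 * Suc n)"
      by (simp only: power_mult[symmetric] mult.commute[of 2] mult_2_right)
    finally have "ln (sqnorm (schrodinger_solution w \<alpha> (Suc n)) (schrodinger_solution w \<alpha> n) (Complex x y))
       \<le> ln (2 * (B + 1) ^ (2 * Suc n))"
      using sqnorm_schrodinger_solution_pos by (intro ln_mono) auto
    also have "\<dots> = ln 2 + real (2 * Suc n) * ln (B + 1)"
      using B0 by (subst ln_mult_pos) (auto simp: ln_realpow simp del: power_Suc mult_Suc_right)
    finally show ?thesis by simp
  qed
  have "log_mean w \<alpha> n y \<le> integral {0..1::real} (\<lambda>x. ln 2 + 2 * real (Suc n) * ln (B + 1))"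
    unfolding log_mean_def by (intro integral_le integrable_log_mean[OF hol y] pt) auto
  then show ?thesis by simp
qed

lemma log_mean_le_cocycle:
  assumes hol: "w holomorphic_on strip d" and d: "d > 0"
    and w: "\<And>t. w (of_real t) = of_real (u t)"
    and int: "(\<lambda>x. ln (matrix_opnorm (cocycle_iterate \<alpha> (schrodinger_cocycle u) n x))) integrable_on {0..1}"
  shows "log_mean w \<alpha> n 0 \<le> 2 * integral {0..1} (\<lambda>x. ln (matrix_opnorm (cocycle_iterate \<alpha> (schrodinger_cocycle u) n x)))"
proof -
  have pt: "ln (sqnorm (schrodinger_solution w \<alpha> (Suc n)) (schrodinger_solution w \<alpha> n) (Complex x 0))
     \<le> 2 * ln (matrix_opnorm (cocycle_iterate \<alpha> (schrodinger_cocycle u) n x))" for x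
  proof -
    let ?N = "sqnorm (schrodinger_solution w \<alpha> (Suc n)) (schrodinger_solution w \<alpha> n) (Complex x 0)"
    have N: "?N > 0" by (rule sqnorm_schrodinger_solution_pos)
    have "sqrt ?N \<le> matrix_opnorm (cocycle_iterate \<alpha> (schrodinger_cocycle u) n x)"
      using matrix_opnorm_ge_column[of "cocycle_iterate \<alpha> (schrodinger_cocycle u) n x" 1]
        cocycle_iterate_column[of w u, OF w]
      by (simp add: sqnorm_def complex_of_real_def)
    then have "ln (sqrt ?N) \<le> ln (matrix_opnorm (cocycle_iterate \<alpha> (schrodinger_cocycle u) n x))"
      using N by (intro ln_mono) auto
    then show ?thesis using N by (simp add: ln_sqrt)
  qed
  have "log_mean w \<alpha> n 0 \<le> integral {0..1} (\<lambda>x. 2 * ln (matrix_opnorm (cocycle_iterate \<alpha> (schrodinger_cocycle u) n x)))"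
    unfolding log_mean_def
    using d int by (intro integral_le integrable_log_mean[OF hol] pt) auto
  then show ?thesis by simp
qed

lemma det_schrodinger_cocycle: "det (schrodinger_cocycle u x) = 1"
  by (simp add: det_2 schrodinger_cocycle_def)

lemma continuous_on_schrodinger_cocycle:
  assumes "continuous_on UNIV u"
  shows "continuous_on UNIV (schrodinger_cocycle u)"
proof -
  have "schrodinger_cocycle u = (\<lambda>x. \<chi> i j. if i = 1 then (if j = 1 then of_real (u x) else - 1) else if j = 1 then 1 else 0)"
    unfolding schrodinger_cocycle_def fun_eq_iff vec_eq_iff forall_2 by simp
  moreover have "continuous_on UNIV (\<lambda>x. if i = (1::2) then (if j = (1::2) then complex_of_real (u x) else - 1) else if j = 1 then 1 else 0)" for i j
    using assms by (cases "i = 1"; cases "j = 1") (auto intro!: continuous_intros)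
  ultimately show ?thesis by (auto intro!: continuous_on_vec_lambda)
qed

section \<open>The lower bound\<close>

text \<open>Convexity at the heights \<open>0 < y < r\<close> solved for the value at height \<open>0\<close>: growth at \<open>y\<close> and the
  trivial upper bound at \<open>r\<close> force growth on the real line. The condition \<open>y \<le> r / 2\<close> keeps the weight
  \<open>1 - y / r\<close> away from \<open>0\<close>, so the loss is at most \<open>\<bar>ln (B + 1) - ln (b / 2)\<bar>\<close>, a quantity in which a
  common scale of \<open>b\<close> and \<open>B\<close> disappears.\<close>
lemma lyapunov_exponent_ge:
  assumes cont: "continuous_on UNIV u" and per: "\<And>x. u (x + 1) = u x"
    and hol: "w holomorphic_on strip d" and d: "0 < d"
    and w: "\<And>t. w (of_real t) = of_real (u t)" and wper: "\<And>z. w (z + 1) = w z"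
    and r: "0 < y" "y \<le> r / 2" "r < d"
    and b: "\<And>x. b \<le> cmod (w (Complex x y))" "b \<ge> 2"
    and B: "\<And>x. cmod (w (Complex x r)) \<le> B"
  shows "lyapunov_exponent \<alpha> (schrodinger_cocycle u) \<ge> ln (b / 2) - \<bar>ln (B + 1) - ln (b / 2)\<bar>"
proof -
  define I where "I n = integral {0..1} (\<lambda>x. ln (matrix_opnorm (cocycle_iterate \<alpha> (schrodinger_cocycle u) n x)))" for n
  define t where "t = y / r"
  have t: "0 < t" "t \<le> 1/2" using r by (auto simp: t_def field_simps)
  define p q where "p = ln (b / 2)" "q = ln (B + 1)"
  have B0: "0 \<le> B" using order_trans[OF norm_ge_zero B] by blast
  have q0: "q \<ge> 0" unfolding p_q_def using B0 by simp
  have lim: "(\<lambda>n. (1 / real n) * I n) \<longlonglongrightarrow> lyapunov_exponent \<alpha> (schrodinger_cocycle u)"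
    unfolding I_def
    by (intro lyapunov_exponent_tendsto continuous_on_schrodinger_cocycle cont det_schrodinger_cocycle)
      (simp add: schrodinger_cocycle_def per)
  have conv: "convex_on {-d<..<d} (log_mean w \<alpha> n)" for n
    unfolding log_mean_def[abs_def]
    using holomorphic_schrodinger_solution[OF hol] sqnorm_schrodinger_solution_pos
      schrodinger_solution_periodic[of w, OF wper]
    by (intro convex_on_integral_ln_sqnorm) auto
  have bound: "p - \<bar>q - p\<bar> - (q + 1) / real n \<le> (1 / real n) * I n" if "n \<ge> 1" for n
  proof -
    have n: "real n > 0" using that by simp
    have "2 * real n * p \<le> log_mean w \<alpha> n y"
      unfolding p_q_def using r by (intro log_mean_lower[OF hol _ b]) auto
    also have "y = (1 - t) *\<^sub>R 0 + t *\<^sub>R r" using r by (simp add: t_def)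
    also have "log_mean w \<alpha> n \<dots> \<le> (1 - t) * log_mean w \<alpha> n 0 + t * log_mean w \<alpha> n r"
      using t r d by (intro convex_onD[OF conv]) auto
    also have "\<dots> \<le> (1 - t) * (2 * I n) + t * (ln 2 + 2 * real (Suc n) * q)"
    proof (intro add_mono mult_left_mono)
      show "log_mean w \<alpha> n 0 \<le> 2 * I n"
        unfolding I_def
        by (intro log_mean_le_cocycle[OF hol d w] integrable_ln_opnorm_cocycle
            continuous_on_schrodinger_cocycle cont det_schrodinger_cocycle)
      show "log_mean w \<alpha> n r \<le> ln 2 + 2 * real (Suc n) * q"
        unfolding p_q_def using r by (intro log_mean_upper[OF hol _ B]) auto
    qed (use t in auto)
    finally have *: "real n * p \<le> (1 - t) * I n + t * (ln 2 / 2 + (real n + 1) * q)"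
      by (simp add: algebra_simps)
    have "ln (2::real) \<le> 1" using ln_le_minus_one[of 2] by simp
    then have "t * (ln 2 / 2 + q) \<le> (1 - t) * (q + 1)"
      using t q0 by (intro mult_mono) auto
    moreover have "t * (real n * (q - p)) \<le> (1 - t) * (real n * \<bar>q - p\<bar>)"
      using t mult_left_mono[of "q - p" "\<bar>q - p\<bar>" "real n"]
      by (intro order_trans[OF mult_left_mono[of "real n * (q - p)" "real n * \<bar>q - p\<bar>" t]] mult_right_mono) auto
    ultimately have "(1 - t) * (real n * p - real n * \<bar>q - p\<bar> - (q + 1)) \<le> (1 - t) * I n"
      using * by (simp add: algebra_simps)
    then have "real n * p - real n * \<bar>q - p\<bar> - (q + 1) \<le> I n"
      using t by simp
    then have "(real n * p - real n * \<bar>q - p\<bar> - (q + 1)) / real n \<le> I n / real n"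
      by (rule divide_right_mono) simp
    then show ?thesis using n by (simp add: diff_divide_distrib)
  qed
  have "(\<lambda>n. p - \<bar>q - p\<bar> - (q + 1) / real n) \<longlonglongrightarrow> p - \<bar>q - p\<bar> - 0"
    by (intro tendsto_diff tendsto_const tendsto_divide_0 filterlim_real_at_infinity_sequentially)
      (use filterlim_real_sequentially in \<open>auto intro: filterlim_at_top_imp_at_infinity\<close>)
  then have "p - \<bar>q - p\<bar> - 0 \<le> lyapunov_exponent \<alpha> (schrodinger_cocycle u)"
    by (rule LIMSEQ_le[OF _ lim]) (use bound in blast)
  then show ?thesis unfolding p_q_def by simp
qed

lemma lyapunov_exponent_nonneg:
  assumes cont: "continuous_on UNIV A" and per: "\<And>x. A (x + 1) = A x" and det: "\<And>x. det (A x) = 1"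
  shows "0 \<le> lyapunov_exponent \<alpha> A"
proof (rule LIMSEQ_le_const[OF lyapunov_exponent_tendsto[OF assms]], intro exI allI impI)
  fix n
  have "0 \<le> ln (matrix_opnorm (cocycle_iterate \<alpha> A n x))" for x
    by (intro ln_ge_zero matrix_opnorm_ge_1 det_cocycle_iterate det)
  then have "0 \<le> integral {0..1} (\<lambda>x. ln (matrix_opnorm (cocycle_iterate \<alpha> A n x)))"
    by (intro integral_nonneg integrable_ln_opnorm_cocycle cont det)
  then show "0 \<le> 1 / real n * integral {0..1} (\<lambda>x. ln (matrix_opnorm (cocycle_iterate \<alpha> A n x)))"
    by simp
qed

theorem mainTheorem5:
  fixes v :: "real \<Rightarrow> real"
  assumes "periodic_one v"
    and "real_analytic v"
    and "\<not> v constant_on UNIV"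
  shows "\<exists>c\<^sub>0::real. \<forall>(\<alpha>::real) (E::real) (lam::real). lam > 0 \<longrightarrow>
           lyapunov_exponent \<alpha> (schrodinger_cocycle (\<lambda>x. E - lam * v x)) \<ge> ln lam + c\<^sub>0"
proof (rule periodic_real_analytic_extension[OF assms(1,2)])
  fix d V assume d: "d > 0" and hol: "V holomorphic_on strip d"
    and V: "\<And>t. V (complex_of_real t) = of_real (v t)" and per: "\<And>z. V (z + 1) = V z"
  have real_strip: "complex_of_real t \<in> strip d" for t using d by (simp add: strip_def)
  have nonconst: "\<not> V constant_on strip d"
    using assms(3) V real_strip unfolding constant_on_def by (metis UNIV_I of_real_eq_iff)
  have vper: "v (t + 1) = v t" for t using assms(1) by (simp add: periodic_one_def)
  have "continuous_on UNIV (\<lambda>t. Re (V (of_real t)))"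
    by (intro continuous_intros continuous_on_compose2[OF holomorphic_on_imp_continuous_on[OF hol]])
      (use real_strip in auto)
  then have vcont: "continuous_on UNIV v" by (simp add: V)
  obtain c :: real where c: "c > 0"
    "\<And>a::real. \<exists>y\<in>{0<..<d/4}. \<forall>x::real. c * (1 + \<bar>a\<bar>) \<le> cmod (V (Complex x y) - a)"
    using line_avoiding_value_uniform[OF hol per nonconst, of "d/4"] d by auto
  obtain K where K: "K \<ge> 0" "\<And>x y. \<bar>y\<bar> \<le> d/2 \<Longrightarrow> cmod (V (Complex x y)) \<le> K"
    using periodic_holomorphic_bounded[OF hol per, of "d/2"] d by auto
  \<comment> \<open>Below \<open>lam0\<close> nonnegativity of the exponent suffices; above it the cone condition \<open>b \<ge> 2\<close> holds
    for \<open>b = c * M\<close>, with \<open>M\<close> the common scale of coupling and energy.\<close>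
  define lam0 where "lam0 = max 1 (2 / c)"
  define C where "C = \<bar>ln (c / 2)\<bar> + \<bar>ln (K + 2) - ln (c / 2)\<bar>"
  have lam0: "lam0 \<ge> 1" "c * lam0 \<ge> 2" using c(1) by (auto simp: lam0_def max_def field_simps)
  show ?thesis
  proof (intro exI[of _ "- C - ln lam0"] allI impI)
    fix \<alpha> E lam :: real assume lam: "lam > 0"
    define u where "u x = E - lam * v x" for x
    have ucont: "continuous_on UNIV u" unfolding u_def by (intro continuous_intros vcont)
    have uper: "u (x + 1) = u x" for x by (simp add: u_def vper)
    show "lyapunov_exponent \<alpha> (schrodinger_cocycle (\<lambda>x. E - lam * v x)) \<ge> ln lam + (- C - ln lam0)"
    proof (cases "lam \<le> lam0")
      case True
      have "0 \<le> lyapunov_exponent \<alpha> (schrodinger_cocycle u)"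
        by (intro lyapunov_exponent_nonneg continuous_on_schrodinger_cocycle ucont det_schrodinger_cocycle)
          (simp add: schrodinger_cocycle_def uper)
      moreover have "ln lam \<le> ln lam0" using True lam by simp
      moreover have "C \<ge> 0" by (simp add: C_def)
      ultimately show ?thesis unfolding u_def by linarith
    next
      case False
      define a where "a = E / lam"
      define M where "M = lam * (1 + \<bar>a\<bar>)"
      have M: "M \<ge> lam" using lam by (simp add: M_def)
      have M1: "M \<ge> 1" "c * M \<ge> 2"
        using M False lam0 mult_left_mono[of lam0 M c] c(1) by linarith+
      define w where "w z = E - lam * V z" for z
      have w_alt: "cmod (w z) = lam * cmod (V z - a)" for z
      proof -
        have "w z = of_real (- lam) * (V z - a)" using lam by (simp add: w_def a_def algebra_simps)
        then show ?thesis using lam by (simp add: norm_mult)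
      qed
      obtain y where y: "y \<in> {0<..<d/4}" "\<And>x. c * (1 + \<bar>a\<bar>) \<le> cmod (V (Complex x y) - a)"
        using c(2)[of a] by blast
      have "ln (c * M / 2) - \<bar>ln (M * (K + 2) - 1 + 1) - ln (c * M / 2)\<bar> \<le> lyapunov_exponent \<alpha> (schrodinger_cocycle u)"
      proof (rule lyapunov_exponent_ge[OF ucont uper, of w d y "d/2"])
        show "w holomorphic_on strip d" unfolding w_def by (intro holomorphic_intros hol)
        show "w (of_real t) = of_real (u t)" for t by (simp add: w_def u_def V)
        show "w (z + 1) = w z" for z by (simp add: w_def per)
        show "c * M \<le> cmod (w (Complex x y))" for x
          using mult_left_mono[OF y(2)[of x], of lam] lam by (simp add: w_alt M_def mult_ac)
        show "cmod (w (Complex x (d/2))) \<le> M * (K + 2) - 1" for x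
        proof -
          have "cmod (V (Complex x (d/2)) - a) \<le> K + \<bar>a\<bar>"
            using norm_triangle_ineq4[of "V (Complex x (d/2))" "of_real a"] K(2)[of "d/2" x] d by simp
          also have "\<dots> \<le> (1 + \<bar>a\<bar>) * (K + 1)" using K(1) by (simp add: algebra_simps)
          finally have "cmod (w (Complex x (d/2))) \<le> M * (K + 1)"
            unfolding w_alt M_def using lam by (simp add: mult.assoc)
          then show ?thesis using M1(1) by (simp add: algebra_simps)
        qed
      qed (use y d M1 in auto)
      moreover have "ln (c * M / 2) = ln M + ln (c / 2)"
        using c(1) M1 ln_mult_pos[of M "c / 2"] by (simp add: mult.commute)
      moreover have "ln (M * (K + 2) - 1 + 1) = ln M + ln (K + 2)"
        using K(1) M1 by (simp add: ln_mult_pos)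
      moreover have "ln lam \<le> ln M" using M lam by simp
      moreover have "ln lam0 \<ge> 0" using lam0 by simp
      ultimately show ?thesis unfolding C_def u_def by linarith
    qed
  qed
qed

end
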